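(* Let $A,B\subset\mathbb{R}$ be convex sets of size $n^{1/2}$ each, and let $S=A\times B\subset\mathbb{R}^2$. Then the number of triangles of area $1$ whose three vertices are points of $S$ is $O(n^{31/14})$, where the implied constant is absolute.
   Context: A finite set $X=\{x_1<x_2<\cdots<x_m\}$ of real numbers is called convex if $x_{i+1}-x_i>x_i-x_{i-1}$ for every $i=2,\ldots,m-1$, i.e., the sequence of differences of consecutive elements is strictly increasing. *)

theory Defs
  imports "HOL-Analysis.Analysis"
begin

definition convex_finite_set :: "real set \<Rightarrow> bool" where
  "convex_finite_set X \<longleftrightarrow> finite X \<and>
     (let x = sorted_list_of_set X in
        \<forall>i. Suc (Suc i) < length x \<longrightarrow>
          x ! Suc (Suc i) - x ! Suc i > x ! Suc i - x ! i)"

definition planar_grid :: "real set \<Rightarrow> real set \<Rightarrow> (real^2) set" where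
  "planar_grid A B = {p. p $ 1 \<in> A \<and> p $ 2 \<in> B}"

text \<open>A triangle is identified with its set of three vertices, so each triangle is counted
  once, irrespective of the order of its vertices. Collinear triples have area \<open>0\<close> and are
  therefore never counted.\<close>

definition unit_area_triangles :: "(real^2) set \<Rightarrow> (real^2) set set" where
  "unit_area_triangles S =
     {T. T \<subseteq> S \<and> card T = 3 \<and> measure lborel (convex hull T) = 1}"

end

theory Submission
  imports Defs
begin

text \<open>Let \<open>m = |A| = |B|\<close>. A triangle with vertices \<open>(c, z)\<close>, \<open>(a, x)\<close>, \<open>(b, y)\<close>, suitably
  ordered, has area 1 iff \<open>(b - c) (x - z) + (c - a) (y - z) = 2\<close>. For fixed \<open>z\<close> this is an
  incidence between the point \<open>(x, y)\<close> of \<open>B \<times> B\<close> and the line with coefficients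
  \<open>(b - c, c - a)\<close>, weighted by the number \<open>w\<close> of triples \<open>(a, b, c)\<close> inducing it.

  Both inputs come from one elementary observation: a chain with at least \<open>t\<close> points in an
  \<open>m \<times> m\<close> grid has many pairs of points at distance \<open>O(m / t)\<close>. Applied to lines, it shows that
  the lines with at least \<open>t\<close> points have incidence counts with sum of squares \<open>O(m^4 / t)\<close>.
  Applied to the pairs of ranks representing a difference in the convex set \<open>A\<close>, it gives
  \<open>O(m^3 log m)\<close> for the third moment of the representation function of \<open>A - A\<close>, which is the
  second moment of \<open>w\<close>. Lines with fewer than \<open>m^(3/7)\<close> points contribute \<open>O(m^(24/7))\<close>
  trivially, the others by AM-GM and the two moment bounds; summing over \<open>z\<close> gives
  \<open>O(m^(31/7))\<close>.\<close>

section \<open>Close pairs of points in a chain\<close>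

text \<open>Cauchy-Schwarz over the fibres of \<open>g\<close>, of which there are at most
  \<open>Q\<close>.\<close>

lemma card_squared_le_same_value_pairs:
  assumes "finite P" and "card (g ` P) \<le> Q"
  shows "(card P)\<^sup>2 \<le> Q * card {(p, p'). p \<in> P \<and> p' \<in> P \<and> g p = g p'}"
proof -
  let ?N = "\<lambda>u. {p \<in> P. g p = u}"
  have fin: "finite (?N u)" for u
    using assms(1) by simp
  have "card P = (\<Sum>u\<in>g ` P. card (?N u))"
    using sum.image_gen[OF assms(1), of "\<lambda>_. 1::nat" g] by simp
  then have "real (card P) = (\<Sum>u\<in>g ` P. real (card (?N u)))"
    by simp
  then have "(real (card P))\<^sup>2 \<le> (\<Sum>u\<in>g ` P. (real (card (?N u)))\<^sup>2) * card (g ` P)"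
    using sum_squared_le_sum_of_squares[of "\<lambda>u. real (card (?N u))" "g ` P"] assms(1) by simp
  then have "real ((card P)\<^sup>2) \<le> real ((\<Sum>u\<in>g ` P. (card (?N u))\<^sup>2) * card (g ` P))"
    by simp
  then have "(card P)\<^sup>2 \<le> (\<Sum>u\<in>g ` P. (card (?N u))\<^sup>2) * card (g ` P)"
    by (simp only: of_nat_le_iff)
  also have "\<dots> \<le> (\<Sum>u\<in>g ` P. (card (?N u))\<^sup>2) * Q"
    using assms(2) by simp
  also have "(\<Sum>u\<in>g ` P. (card (?N u))\<^sup>2) = card (SIGMA u:g ` P. ?N u \<times> ?N u)"
    using assms(1) fin by (simp add: power2_eq_square card_cartesian_product)
  also have "card (SIGMA u:g ` P. ?N u \<times> ?N u)
      \<le> card {(p, p'). p \<in> P \<and> p' \<in> P \<and> g p = g p'}"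
  proof (rule card_inj_on_le[where f = snd])
    show "inj_on snd (SIGMA u:g ` P. ?N u \<times> ?N u)"
      by (auto simp: inj_on_def)
    show "snd ` (SIGMA u:g ` P. ?N u \<times> ?N u) \<subseteq> {(p, p'). p \<in> P \<and> p' \<in> P \<and> g p = g p'}"
      by auto
    show "finite {(p, p'). p \<in> P \<and> p' \<in> P \<and> g p = g p'}"
      by (rule finite_subset[of _ "P \<times> P"]) (use assms(1) in auto)
  qed
  finally show ?thesis
    by (simp add: mult.commute)
qed

lemma div_eq_imp_close:
  fixes a b H :: nat
  assumes "a div H = b div H" "H > 0"
  shows "\<bar>int a - int b\<bar> < int H"
proof -
  have "a = H * (a div H) + a mod H" "b = H * (a div H) + b mod H"
    using assms(1) by (metis mult_div_mod_eq)+
  moreover have "a mod H < H" "b mod H < H" using assms(2) by auto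
  ultimately show ?thesis by linarith
qed

text \<open>Cut the grid into square blocks of side \<open>H\<close>. A chain meets at most \<open>2 m / H + 1\<close>
  blocks, since the sum of the two block coordinates separates them.\<close>

lemma card_squared_le_close_pairs_chain:
  fixes f h :: "'a \<Rightarrow> nat"
  assumes fin: "finite P"
    and f: "\<And>p. p \<in> P \<Longrightarrow> f p < m" and h: "\<And>p. p \<in> P \<Longrightarrow> h p < m"
    and chain: "\<And>p p'. p \<in> P \<Longrightarrow> p' \<in> P \<Longrightarrow> f p \<le> f p' \<and> h p \<le> h p' \<or> f p' \<le> f p \<and> h p' \<le> h p"
    and t: "4 \<le> t" "t \<le> card P" and H: "H = 8 * m div t + 1"
  shows "(card P)\<^sup>2 \<le> t * card {(p, p'). p \<in> P \<and> p' \<in> P \<and> p \<noteq> p' \<and>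
            \<bar>int (f p) - int (f p')\<bar> < int H \<and> \<bar>int (h p) - int (h p')\<bar> < int H}"
    (is "_ \<le> t * card ?E")
proof -
  let ?g = "\<lambda>p. f p div H + h p div H"
  let ?S = "{(p, p'). p \<in> P \<and> p' \<in> P \<and> ?g p = ?g p'}"
  define Q where "Q = 2 * (m div H) + 1"
  have H0: "H > 0" using H by simp
  have "?g p \<in> {..<Q}" if "p \<in> P" for p
  proof -
    have "f p div H \<le> m div H" "h p div H \<le> m div H"
      using f[OF that] h[OF that] by (auto intro: div_le_mono)
    then show ?thesis by (simp add: Q_def)
  qed
  then have "card (?g ` P) \<le> card {..<Q}"
    by (intro card_mono) auto
  then have cg: "card (?g ` P) \<le> Q" by simp
  \<comment> \<open>The \<open>+ 1\<close> in \<open>H\<close> makes this strict. With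
    \<open>4 \<le> t\<close> it yields \<open>2 * Q \<le> t\<close>, which later absorbs the
    diagonal pairs.\<close>
  have "8 * m < t * H"
    using dividend_less_times_div[of t "8 * m"] t(1) unfolding H by simp
  moreover have "m div H * H \<le> m" by simp
  ultimately have "(8 * (m div H)) * H < t * H"
    by (metis (no_types, lifting) le_less_trans mult.assoc mult_le_mono2)
  then have "8 * (m div H) < t" using mult_less_cancel2 by blast
  moreover have aux: "2 * (2 * d + 1) \<le> t" if "8 * d < t" for d
    using that t(1) by arith
  ultimately have Q: "2 * Q \<le> t" unfolding Q_def using aux by blast
  have finE: "finite ?E"
    by (rule finite_subset[of _ "P \<times> P"]) (use fin in auto)
  \<comment> \<open>Along a chain both quotients by \<open>H\<close> move the same way, so equal
    sums force equal quotients, that is, the same block.\<close>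
  have "?S \<subseteq> ?E \<union> (\<lambda>p. (p, p)) ` P"
  proof (clarify, rule ccontr)
    fix p p' assume p: "p \<in> P" "p' \<in> P" and eq: "?g p = ?g p'"
      and n: "(p, p') \<notin> (\<lambda>p. (p, p)) ` P"
      and nE: "\<not> (p \<noteq> p' \<and> \<bar>int (f p) - int (f p')\<bar> < int H \<and> \<bar>int (h p) - int (h p')\<bar> < int H)"
    have "f p div H = f p' div H \<and> h p div H = h p' div H"
      using chain[OF p]
    proof
      assume "f p \<le> f p' \<and> h p \<le> h p'"
      then have "f p div H \<le> f p' div H" "h p div H \<le> h p' div H" by (auto intro: div_le_mono)
      then show ?thesis using eq by linarith
    next
      assume "f p' \<le> f p \<and> h p' \<le> h p"
      then have "f p' div H \<le> f p div H" "h p' div H \<le> h p div H" by (auto intro: div_le_mono)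
      then show ?thesis using eq by linarith
    qed
    then show False
      using nE n p div_eq_imp_close[OF _ H0] by blast
  qed
  then have "card ?S \<le> card (?E \<union> (\<lambda>p. (p, p)) ` P)"
    using finE fin by (intro card_mono) auto
  also have "\<dots> \<le> card ?E + card P"
    using card_Un_le[of ?E "(\<lambda>p. (p, p)) ` P"] card_image_le[OF fin, of "\<lambda>p. (p, p)"] by linarith
  finally have S: "card ?S \<le> card ?E + card P" .
  have "(card P)\<^sup>2 \<le> Q * (card ?E + card P)"
    using card_squared_le_same_value_pairs[OF fin cg] S by (meson le_trans mult_le_mono2)
  \<comment> \<open>After doubling, the diagonal costs at most one copy of
    \<open>(card P)\<^sup>2\<close>, because \<open>2 * Q \<le> t \<le> card P\<close>.\<close>
  then have "2 * (card P)\<^sup>2 \<le> 2 * Q * card ?E + 2 * Q * card P"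
    by (simp add: algebra_simps)
  also have "\<dots> \<le> t * card ?E + card P * card P"
    using Q t(2) by (intro add_mono mult_right_mono) auto
  finally show ?thesis
    by (simp add: power2_eq_square)
qed

section \<open>Ranks in a finite set and convexity\<close>

text \<open>For \<open>x\<close> in \<open>A\<close>, the zero-based position in the increasing
  enumeration. It serves as the integer grid coordinate that is cut into blocks.\<close>

definition rank_in :: "real set \<Rightarrow> real \<Rightarrow> nat" where
  "rank_in A x = card {y \<in> A. y < x}"

lemma rank_in_less_card:
  assumes "finite A" "x \<in> A"
  shows "rank_in A x < card A"
  unfolding rank_in_def using assms by (intro psubset_card_mono) auto

lemma rank_in_mono:
  assumes "finite A" "x \<le> y"
  shows "rank_in A x \<le> rank_in A y"
  unfolding rank_in_def using assms by (intro card_mono) auto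

lemma rank_in_strict_mono:
  assumes "finite A" "x \<in> A" "x < y"
  shows "rank_in A x < rank_in A y"
  unfolding rank_in_def using assms by (intro psubset_card_mono) auto

lemma inj_on_rank_in: "finite A \<Longrightarrow> inj_on (rank_in A) A"
  by (metis inj_onI linorder_neq_iff less_irrefl rank_in_strict_mono)

lemma rank_in_nth_sorted_list_of_set:
  assumes "finite A" "i < card A"
  shows "rank_in A (sorted_list_of_set A ! i) = i"
proof -
  let ?xs = "sorted_list_of_set A"
  have s: "sorted_wrt (<) ?xs" by simp
  have l: "length ?xs = card A" by simp
  have "{y \<in> A. y < ?xs ! i} = (!) ?xs ` {..<i}"
  proof
    show "{y \<in> A. y < ?xs ! i} \<subseteq> (!) ?xs ` {..<i}"
    proof
      fix y assume y: "y \<in> {y \<in> A. y < ?xs ! i}"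
      then obtain j where j: "j < card A" "y = ?xs ! j"
        using assms(1) by (metis (no_types, lifting) in_set_conv_nth l mem_Collect_eq set_sorted_list_of_set)
      then have "\<not> i < j" "i \<noteq> j"
        using y sorted_wrt_nth_less[OF s, of i j] l by auto
      then show "y \<in> (!) ?xs ` {..<i}" using j by auto
    qed
    show "(!) ?xs ` {..<i} \<subseteq> {y \<in> A. y < ?xs ! i}"
      using assms sorted_wrt_nth_less[OF s, of _ i] nth_mem[of _ ?xs] by auto
  qed
  moreover have "inj_on ((!) ?xs) {..<i}"
    using assms by (intro inj_on_nth) auto
  ultimately show ?thesis
    unfolding rank_in_def by (simp add: card_image)
qed

text \<open>Gaps between neighbours increase, so for fixed \<open>k > 0\<close> the span from
  position \<open>i\<close> to \<open>i + k\<close> strictly increases with \<open>i\<close>. A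
  nonzero difference and its rank gap thus determine the pair.\<close>

lemma convex_finite_set_rank_diff_unique:
  assumes A: "convex_finite_set A"
    and in_A: "x \<in> A" "y \<in> A" "x' \<in> A" "y' \<in> A"
    and diff: "y - x = y' - x'" "x \<noteq> y"
    and rk: "int (rank_in A y) - int (rank_in A x) = int (rank_in A y') - int (rank_in A x')"
  shows "x = x'"
proof -
  let ?a = "\<lambda>i. sorted_list_of_set A ! i"
  have fin: "finite A" using A by (simp add: convex_finite_set_def)
  have nth_rank_in: "?a (rank_in A z) = z" if z: "z \<in> A" for z
  proof -
    obtain i where "i < card A" "z = ?a i"
      using z fin in_set_conv_nth[of z "sorted_list_of_set A"] by auto
    then show ?thesis using rank_in_nth_sorted_list_of_set[OF fin] by simp
  qed
  have step: "?a (Suc i) - ?a i < ?a (Suc (Suc i)) - ?a (Suc i)" if "Suc (Suc i) < card A" for i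
    using A[unfolded convex_finite_set_def Let_def, THEN conjunct2, rule_format, of i] that by simp
  have gap: "?a (Suc i) - ?a i < ?a (Suc j) - ?a j" if "i < j" "Suc j < card A" for i j
    using that
  proof (induction j)
    case (Suc j)
    then show ?case using step[of j] by (cases "i = j") auto
  qed simp
  have long: "?a (i + Suc k) - ?a i < ?a (j + Suc k) - ?a j" if "i < j" "j + Suc k < card A" for i j k
    using that
  proof (induction k)
    case 0
    then show ?case using gap[of i j] by simp
  next
    case (Suc k)
    then show ?case using gap[of "i + Suc k" "j + Suc k"] by force
  qed
  have up: "u = u'" if uv: "u \<in> A" "v \<in> A" "u' \<in> A" "v' \<in> A" "v - u = v' - u'" "u < v"
    "int (rank_in A v) - int (rank_in A u) = int (rank_in A v') - int (rank_in A u')" for u v u' v'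
  proof -
    have r: "rank_in A u < rank_in A v" using rank_in_strict_mono[OF fin] uv by auto
    then obtain k where k: "rank_in A v = rank_in A u + Suc k"
      by (metis less_iff_Suc_add add_Suc_right)
    then have k': "rank_in A v' = rank_in A u' + Suc k" using uv(7) by linarith
    have "\<not> rank_in A u < rank_in A u'" "\<not> rank_in A u' < rank_in A u"
      using long[of "rank_in A u" "rank_in A u'" k] long[of "rank_in A u'" "rank_in A u" k]
        rank_in_less_card[OF fin uv(2)] rank_in_less_card[OF fin uv(4)]
        nth_rank_in[OF uv(1)] nth_rank_in[OF uv(2)] nth_rank_in[OF uv(3)] nth_rank_in[OF uv(4)] k k' uv(5)
      by auto
    then have "rank_in A u = rank_in A u'" by simp
    then show ?thesis using nth_rank_in uv by metis
  qed
  show ?thesis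
  proof (cases "x < y")
    case True
    then show ?thesis using up[of x y x' y'] in_A diff rk by simp
  next
    case False
    then have "y < x" using diff(2) by simp
    then have "y = y'" using up[of y x y' x'] in_A diff rk by simp
    then show ?thesis using diff(1) by simp
  qed
qed

definition near_pairs :: "real set \<Rightarrow> nat \<Rightarrow> (real \<times> real) set" where
  "near_pairs A H = {(x, x'). x \<in> A \<and> x' \<in> A \<and> \<bar>int (rank_in A x) - int (rank_in A x')\<bar> < int H}"

lemma finite_near_pairs: "finite A \<Longrightarrow> finite (near_pairs A H)"
  unfolding near_pairs_def by (rule finite_subset[of _ "A \<times> A"]) auto

lemma card_near_pairs_le:
  assumes "finite A"
  shows "card (near_pairs A H) \<le> card A * (2 * H)"
proof -
  have "near_pairs A H \<subseteq> (SIGMA x:A. {x' \<in> A. \<bar>int (rank_in A x) - int (rank_in A x')\<bar> < int H})"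
    by (auto simp: near_pairs_def)
  then have "card (near_pairs A H)
      \<le> card (SIGMA x:A. {x' \<in> A. \<bar>int (rank_in A x) - int (rank_in A x')\<bar> < int H})"
    using assms by (intro card_mono) auto
  also have "\<dots> = (\<Sum>x\<in>A. card {x' \<in> A. \<bar>int (rank_in A x) - int (rank_in A x')\<bar> < int H})"
    using assms by simp
  also have "\<dots> \<le> (\<Sum>x\<in>A. 2 * H)"
  proof (rule sum_mono)
    fix x assume "x \<in> A"
    have "card {x' \<in> A. \<bar>int (rank_in A x) - int (rank_in A x')\<bar> < int H}
        \<le> card {rank_in A x + 1 - H..<rank_in A x + H}"
    proof (rule card_inj_on_le[where f = "rank_in A"])
      show "inj_on (rank_in A) {x' \<in> A. \<bar>int (rank_in A x) - int (rank_in A x')\<bar> < int H}"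
        using inj_on_rank_in[OF assms] by (rule inj_on_subset) auto
    qed auto
    then show "card {x' \<in> A. \<bar>int (rank_in A x) - int (rank_in A x')\<bar> < int H} \<le> 2 * H"
      by simp
  qed
  finally show ?thesis by simp
qed

lemma sum_card_le_of_inj_on:
  assumes "finite I" "\<And>i. i \<in> I \<Longrightarrow> finite (C i)"
    and "inj_on F (SIGMA i:I. C i)" "F ` (SIGMA i:I. C i) \<subseteq> N" "finite N"
  shows "(\<Sum>i\<in>I. card (C i)) \<le> card N"
  using card_inj_on_le[OF assms(3-5)] assms(1,2) by simp

section \<open>Third moment of the representation function of A - A\<close>

definition diff_reps :: "real set \<Rightarrow> real \<Rightarrow> (real \<times> real) set" where
  "diff_reps A d = {(x, y). x \<in> A \<and> y \<in> A \<and> y - x = d}"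

lemma finite_diff_reps: "finite A \<Longrightarrow> finite (diff_reps A d)"
  unfolding diff_reps_def by (rule finite_subset[of _ "A \<times> A"]) auto

lemma card_diff_reps_le: "finite A \<Longrightarrow> card (diff_reps A d) \<le> card A"
  by (rule card_inj_on_le[where f = fst]) (auto simp: diff_reps_def inj_on_def)

lemma sum_card_diff_reps_le:
  assumes "finite A" "finite D"
  shows "(\<Sum>d\<in>D. card (diff_reps A d)) \<le> card A * card A"
proof -
  have "(\<Sum>d\<in>D. card (diff_reps A d)) \<le> card (A \<times> A)"
    by (rule sum_card_le_of_inj_on[where F = snd])
       (use assms finite_diff_reps in \<open>auto simp: inj_on_def diff_reps_def\<close>)
  then show ?thesis by (simp add: card_cartesian_product)
qed

text \<open>Two representations \<open>b - a = b' - a'\<close> of a popular difference with nearby ranks give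
  \<open>b' - b = a' - a\<close>, a coincidence of short differences. Convexity recovers \<open>b\<close> and \<open>b'\<close> from
  \<open>a\<close>, \<open>a'\<close> and the rank gap between \<open>b\<close> and \<open>b'\<close>.\<close>

lemma sum_card_diff_reps_squared_le:
  assumes A: "convex_finite_set A" and D: "finite D"
    and t: "4 \<le> t" and H: "H = 8 * card A div t + 1"
  shows "(\<Sum>d\<in>{d \<in> D. t \<le> card (diff_reps A d)}. (card (diff_reps A d))\<^sup>2)
         \<le> t * ((card A * (2 * H)) * (2 * H))"
proof -
  have fin: "finite A" using A by (simp add: convex_finite_set_def)
  let ?D = "{d \<in> D. t \<le> card (diff_reps A d)}"
  define C where "C d = {(p, p'). p \<in> diff_reps A d \<and> p' \<in> diff_reps A d \<and> p \<noteq> p' \<and>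
            \<bar>int (rank_in A (fst p)) - int (rank_in A (fst p'))\<bar> < int H \<and>
            \<bar>int (rank_in A (snd p)) - int (rank_in A (snd p'))\<bar> < int H}" for d
  let ?F = "\<lambda>e. case e of (d, (a, b), (a', b')) \<Rightarrow>
      ((a, a'), int (rank_in A b') - int (rank_in A b))"
  have finC: "finite (C d)" for d
    unfolding C_def by (rule finite_subset[of _ "diff_reps A d \<times> diff_reps A d"])
      (use finite_diff_reps[OF fin] in auto)
  have sq: "(card (diff_reps A d))\<^sup>2 \<le> t * card (C d)" if "d \<in> ?D" for d
    unfolding C_def
  proof (rule card_squared_le_close_pairs_chain[where m = "card A"])
    fix p p' assume p: "p \<in> diff_reps A d" "p' \<in> diff_reps A d"
    show "rank_in A (fst p) < card A" "rank_in A (snd p) < card A"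
      using p rank_in_less_card[OF fin] by (auto simp: diff_reps_def)
    have "fst p \<le> fst p' \<and> snd p \<le> snd p' \<or> fst p' \<le> fst p \<and> snd p' \<le> snd p"
      using p by (auto simp: diff_reps_def)
    then show "rank_in A (fst p) \<le> rank_in A (fst p') \<and> rank_in A (snd p) \<le> rank_in A (snd p') \<or>
       rank_in A (fst p') \<le> rank_in A (fst p) \<and> rank_in A (snd p') \<le> rank_in A (snd p)"
      using rank_in_mono[OF fin] by blast
  qed (use that t H finite_diff_reps[OF fin] in auto)
  have "(\<Sum>d\<in>?D. card (C d)) \<le> card (near_pairs A H \<times> {- int H<..<int H})"
  proof (rule sum_card_le_of_inj_on[where F = ?F])
    show "inj_on ?F (SIGMA d:?D. C d)"
    proof (rule inj_onI)
      fix e1 e2 assume e: "e1 \<in> (SIGMA d:?D. C d)" "e2 \<in> (SIGMA d:?D. C d)" "?F e1 = ?F e2"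
      obtain d1 a b a' b' where e1: "e1 = (d1, (a, b), (a', b'))"
        by (metis prod.collapse)
      obtain d2 u v u' v' where e2: "e2 = (d2, (u, v), (u', v'))"
        by (metis prod.collapse)
      have eq: "u = a" "u' = a'"
        "int (rank_in A b') - int (rank_in A b) = int (rank_in A v') - int (rank_in A v)"
        using e(3) unfolding e1 e2 by auto
      have in1: "a \<in> A" "b \<in> A" "a' \<in> A" "b' \<in> A" "b - a = d1" "b' - a' = d1" "(a, b) \<noteq> (a', b')"
        using e(1) unfolding e1 C_def diff_reps_def by auto
      have in2: "v \<in> A" "v' \<in> A" "v - a = d2" "v' - a' = d2"
        using e(2) unfolding e2 C_def diff_reps_def eq by auto
      \<comment> \<open>Both \<open>b' - b\<close> and \<open>v' - v\<close> equal
        \<open>a' - a\<close>. This is nonzero, since \<open>b = b'\<close> would also give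
        \<open>a = a'\<close>.\<close>
      have "b = v"
        by (rule convex_finite_set_rank_diff_unique[OF A, of b b' v v'])
           (use in1 in2 eq in auto)
      then show "e1 = e2"
        unfolding e1 e2 using eq in1 in2 by auto
    qed
    show "?F ` (SIGMA d:?D. C d) \<subseteq> near_pairs A H \<times> {- int H<..<int H}"
      by (auto simp: C_def near_pairs_def diff_reps_def)
  qed (use D finC finite_near_pairs[OF fin] in auto)
  also have "\<dots> \<le> (card A * (2 * H)) * (2 * H)"
    unfolding card_cartesian_product by (intro mult_le_mono card_near_pairs_le[OF fin]) auto
  finally have "t * (\<Sum>d\<in>?D. card (C d)) \<le> t * ((card A * (2 * H)) * (2 * H))"
    by (rule mult_le_mono2)
  moreover have "(\<Sum>d\<in>?D. (card (diff_reps A d))\<^sup>2) \<le> (\<Sum>d\<in>?D. t * card (C d))"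
    using sq by (rule sum_mono)
  ultimately show ?thesis
    by (simp add: sum_distrib_left)
qed

text \<open>The \<open>+ 1\<close> from rounding is at most \<open>c * m / t\<close>, so
  \<open>H\<close> has order \<open>m / t\<close>.\<close>

lemma real_side_le:
  fixes m t H :: nat
  assumes "H = 8 * m div t + 1" "0 < t" "t \<le> c * m"
  shows "real H \<le> (8 + c) * m / t"
proof -
  have "real (8 * m div t) \<le> real (8 * m) / t"
    using of_nat_div_le_of_nat by blast
  moreover have "1 \<le> real c * m / t"
    using assms(2,3) by (simp add: le_divide_eq flip: of_nat_mult)
  ultimately show ?thesis
    using assms(1) by (simp add: add_divide_distrib distrib_right)
qed

lemma real_sum_card_diff_reps_squared_le:
  assumes A: "convex_finite_set A" and D: "finite D" and t: "1 \<le> t" "t \<le> card A"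
  shows "(\<Sum>d\<in>{d \<in> D. t \<le> card (diff_reps A d)}. (real (card (diff_reps A d)))\<^sup>2)
         \<le> 324 * real (card A) ^ 3 / t"
proof (cases "4 \<le> t")
  case True
  define H where "H = 8 * card A div t + 1"
  have "real H \<le> (8 + real 1) * card A / t"
    using real_side_le[of H "card A" t 1] t by (simp add: H_def)
  then have Hb: "real H \<le> 9 * card A / t" by simp
  have "(\<Sum>d\<in>{d \<in> D. t \<le> card (diff_reps A d)}. (real (card (diff_reps A d)))\<^sup>2)
     = real (\<Sum>d\<in>{d \<in> D. t \<le> card (diff_reps A d)}. (card (diff_reps A d))\<^sup>2)"
    by simp
  also have "\<dots> \<le> real (t * ((card A * (2 * H)) * (2 * H)))"
    by (intro of_nat_mono sum_card_diff_reps_squared_le[OF A D True H_def])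
  also have "\<dots> = 4 * t * card A * (real H)\<^sup>2"
    by (simp add: power2_eq_square)
  also have "\<dots> \<le> 4 * t * card A * (9 * card A / t)\<^sup>2"
    using Hb by (intro mult_left_mono power_mono) auto
  also have "\<dots> = 324 * real (card A) ^ 3 / t"
    using t by (simp add: field_simps power2_eq_square power3_eq_cube)
  finally show ?thesis .
next
  case False
  have fin: "finite A" using A by (simp add: convex_finite_set_def)
  \<comment> \<open>For \<open>t < 4\<close> the trivial bound suffices: each count is at most
    \<open>card A\<close>, their sum is at most \<open>card A * card A\<close>, and
    \<open>324 / t \<ge> 1\<close>.\<close>
  have "(\<Sum>d\<in>{d \<in> D. t \<le> card (diff_reps A d)}. (card (diff_reps A d))\<^sup>2)
      \<le> (\<Sum>d\<in>{d \<in> D. t \<le> card (diff_reps A d)}. card A * card (diff_reps A d))"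
    unfolding power2_eq_square using card_diff_reps_le[OF fin] by (intro sum_mono mult_le_mono) auto
  also have "\<dots> = card A * (\<Sum>d\<in>{d \<in> D. t \<le> card (diff_reps A d)}. card (diff_reps A d))"
    by (simp add: sum_distrib_left)
  also have "\<dots> \<le> card A * (card A * card A)"
    using D by (intro mult_le_mono2 sum_card_diff_reps_le[OF fin]) auto
  finally have "real (\<Sum>d\<in>{d \<in> D. t \<le> card (diff_reps A d)}. (card (diff_reps A d))\<^sup>2)
      \<le> real (card A * (card A * card A))"
    by (rule of_nat_mono)
  then have "(\<Sum>d\<in>{d \<in> D. t \<le> card (diff_reps A d)}. (real (card (diff_reps A d)))\<^sup>2)
      \<le> real (card A) ^ 3"
    by (simp add: power3_eq_cube)
  also have "\<dots> \<le> real (card A) ^ 3 * (324 / t)"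
    using False t mult_left_mono[of 1 "324 / real t" "real (card A) ^ 3"] by (simp add: field_simps)
  finally show ?thesis by (simp add: mult.commute)
qed

text \<open>Layer cake: \<open>r ^ 3\<close> is \<open>r ^ 2\<close> summed over the thresholds
  \<open>t = 1..r\<close>. Summing over \<open>d\<close> first turns the bounds for each threshold
  into a harmonic sum.\<close>

lemma sum_card_diff_reps_cubed_le:
  assumes A: "convex_finite_set A" and D: "finite D"
  shows "(\<Sum>d\<in>D. (real (card (diff_reps A d))) ^ 3)
         \<le> 324 * real (card A) ^ 3 * (\<Sum>t = 1..card A. 1 / real t)"
proof -
  have fin: "finite A" using A by (simp add: convex_finite_set_def)
  let ?c = "\<lambda>d. card (diff_reps A d)"
  have "real (?c d) ^ 3 = (\<Sum>t = 1..card A. if t \<le> ?c d then (real (?c d))\<^sup>2 else 0)" for d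
  proof -
    have "(\<Sum>t = 1..card A. if t \<le> ?c d then (real (?c d))\<^sup>2 else 0)
        = (\<Sum>t\<in>{1..?c d}. (real (?c d))\<^sup>2)"
      using card_diff_reps_le[OF fin, of d] by (intro sum.mono_neutral_cong_right) auto
    then show ?thesis by (simp add: power3_eq_cube power2_eq_square)
  qed
  then have "(\<Sum>d\<in>D. real (?c d) ^ 3)
      = (\<Sum>d\<in>D. \<Sum>t = 1..card A. if t \<le> ?c d then (real (?c d))\<^sup>2 else 0)"
    by simp
  also have "\<dots> = (\<Sum>t = 1..card A. \<Sum>d\<in>D. if t \<le> ?c d then (real (?c d))\<^sup>2 else 0)"
    by (rule sum.swap)
  also have "\<dots> = (\<Sum>t = 1..card A. \<Sum>d\<in>{d \<in> D. t \<le> ?c d}. (real (?c d))\<^sup>2)"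
    using D by (simp add: sum.inter_filter)
  also have "\<dots> \<le> (\<Sum>t = 1..card A. 324 * real (card A) ^ 3 / t)"
    using real_sum_card_diff_reps_squared_le[OF A D] by (intro sum_mono) auto
  finally show ?thesis
    by (simp add: sum_distrib_left)
qed

text \<open>Trades the logarithm for a small power, so that the final bound is a pure power.\<close>

lemma sum_inverse_le_powr:
  fixes \<epsilon> :: real
  assumes "0 < \<epsilon>"
  shows "(\<Sum>t = 1..m. 1 / real t) \<le> (1 + 1 / \<epsilon>) * real m powr \<epsilon>"
proof (cases "m = 0")
  case False
  have log: "(\<Sum>t = 1..Suc k. 1 / real t) \<le> 1 + ln (Suc k)" for k
  proof (induction k)
    case (Suc k)
    \<comment> \<open>From \<open>ln x \<le> x - 1\<close> at
      \<open>x = (k + 1) / (k + 2)\<close>.\<close>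
    have "1 / real (Suc (Suc k)) \<le> ln (Suc (Suc k)) - ln (Suc k)"
      using ln_le_minus_one[of "real (Suc k) / Suc (Suc k)"]
      by (simp add: ln_div field_simps)
    then show ?case using Suc by simp
  qed simp
  obtain k where k: "m = Suc k" using False by (cases m) auto
  have "(\<Sum>t = 1..m. 1 / real t) \<le> 1 + ln m" using log k by simp
  also have "\<dots> \<le> m powr \<epsilon> + m powr \<epsilon> / \<epsilon>"
    using False assms by (intro add_mono ln_powr_bound ge_one_powr_ge_zero) auto
  finally show ?thesis by (simp add: algebra_simps)
qed simp

section \<open>Rich lines in B x B\<close>

text \<open>\<open>l\<close> holds the two coefficients, and \<open>z\<close> shifts the line along
  the diagonal. The right side is twice the area; being nonzero, it leaves no points for
  \<open>l = (0, 0)\<close>.\<close>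

definition line_points :: "real set \<Rightarrow> real \<Rightarrow> real \<times> real \<Rightarrow> (real \<times> real) set" where
  "line_points B z l = {(x, y). x \<in> B \<and> y \<in> B \<and> fst l * (x - z) + snd l * (y - z) = 2}"

lemma finite_line_points: "finite B \<Longrightarrow> finite (line_points B z l)"
  unfolding line_points_def by (rule finite_subset[of _ "B \<times> B"]) auto

text \<open>Displacements along a line of nonnegative or vertical slope never rise in one coordinate
  while falling in the other: multiplying by \<open>r\<close> makes a positive multiple of
  \<open>u\<close> equal to a nonnegative multiple of \<open>v\<close>.\<close>

lemma same_sign_of_mult_eq:
  fixes r s u v :: real
  assumes "r * u = - s * v" "r \<noteq> 0 \<or> s \<noteq> 0" "r * s \<le> 0"
  shows "u \<le> 0 \<and> v \<le> 0 \<or> 0 \<le> u \<and> 0 \<le> v"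
proof (cases "r = 0")
  case True
  then show ?thesis using assms by auto
next
  case False
  have e: "r\<^sup>2 * u = - (r * s) * v"
    using assms(1) by algebra
  have r: "0 < r\<^sup>2" using False by simp
  show ?thesis
  proof (rule ccontr)
    assume "\<not> ?thesis"
    then consider "0 < u" "v < 0" | "u < 0" "0 < v" by force
    then show False
    proof cases
      case 1
      then have "0 < r\<^sup>2 * u" "- (r * s) * v \<le> 0"
        using r assms(3) by (auto intro: mult_pos_pos mult_nonneg_nonpos simp: mult_nonpos_nonpos)
      then show False using e by simp
    next
      case 2
      then have "r\<^sup>2 * u < 0" "0 \<le> - (r * s) * v"
        using r assms(3) by (auto intro: mult_pos_neg simp: mult_nonpos_nonneg)
      then show False using e by simp
    qed
  qed
qed

text \<open>The points of a line form a chain, after reversing the second coordinate if the line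
  decreases.\<close>

lemma line_points_close_pairs:
  assumes fin: "finite B" and t: "4 \<le> t" "t \<le> card (line_points B z l)"
    and H: "H = 8 * card B div t + 1"
  shows "(card (line_points B z l))\<^sup>2 \<le>
    t * card {(p, p'). p \<in> line_points B z l \<and> p' \<in> line_points B z l \<and> p \<noteq> p' \<and>
            \<bar>int (rank_in B (fst p)) - int (rank_in B (fst p'))\<bar> < int H \<and>
            \<bar>int (rank_in B (snd p)) - int (rank_in B (snd p'))\<bar> < int H}"
proof (cases "fst l * snd l \<le> 0")
  case True
  show ?thesis
  proof (rule card_squared_le_close_pairs_chain[where m = "card B"])
    fix p p' assume p: "p \<in> line_points B z l" "p' \<in> line_points B z l"
    show "rank_in B (fst p) < card B" "rank_in B (snd p) < card B"
      using p rank_in_less_card[OF fin] by (auto simp: line_points_def)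
    have e: "fst l * (fst p - fst p') = - snd l * (snd p - snd p')"
      and nz: "fst l \<noteq> 0 \<or> snd l \<noteq> 0"
      using p by (auto simp: line_points_def algebra_simps)
    have "fst p \<le> fst p' \<and> snd p \<le> snd p' \<or> fst p' \<le> fst p \<and> snd p' \<le> snd p"
      using same_sign_of_mult_eq[OF e nz True] by auto
    then show "rank_in B (fst p) \<le> rank_in B (fst p') \<and> rank_in B (snd p) \<le> rank_in B (snd p') \<or>
       rank_in B (fst p') \<le> rank_in B (fst p) \<and> rank_in B (snd p') \<le> rank_in B (snd p)"
      using rank_in_mono[OF fin] by blast
  qed (use t H finite_line_points[OF fin] in auto)
next
  case False
  \<comment> \<open>Reversal of the second rank, which preserves rank distances. Truncation never
    occurs, as ranks of line points are below \<open>card B\<close>.\<close>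
  let ?h = "\<lambda>p. card B - 1 - rank_in B (snd p)"
  let ?E = "{(p, p'). p \<in> line_points B z l \<and> p' \<in> line_points B z l \<and> p \<noteq> p' \<and>
            \<bar>int (rank_in B (fst p)) - int (rank_in B (fst p'))\<bar> < int H \<and>
            \<bar>int (?h p) - int (?h p')\<bar> < int H}"
  have less: "rank_in B (fst p) < card B" "rank_in B (snd p) < card B" if "p \<in> line_points B z l" for p
    using that rank_in_less_card[OF fin] by (auto simp: line_points_def)
  have "(card (line_points B z l))\<^sup>2 \<le> t * card ?E"
  proof (rule card_squared_le_close_pairs_chain[where m = "card B"])
    fix p p' assume p: "p \<in> line_points B z l" "p' \<in> line_points B z l"
    show "rank_in B (fst p) < card B" "?h p < card B"
      using less[OF p(1)] by auto
    have e: "fst l * (fst p - fst p') = - (- snd l) * (- (snd p - snd p'))"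
      and nz: "fst l \<noteq> 0 \<or> - snd l \<noteq> 0"
      using p by (auto simp: line_points_def algebra_simps)
    have "fst p \<le> fst p' \<and> snd p' \<le> snd p \<or> fst p' \<le> fst p \<and> snd p \<le> snd p'"
      using same_sign_of_mult_eq[OF e nz] False by auto
    then show "rank_in B (fst p) \<le> rank_in B (fst p') \<and> ?h p \<le> ?h p' \<or>
       rank_in B (fst p') \<le> rank_in B (fst p) \<and> ?h p' \<le> ?h p"
      using rank_in_mono[OF fin] diff_le_mono2 by blast
  qed (use t H finite_line_points[OF fin] in auto)
  moreover have "\<bar>int (?h p) - int (?h p')\<bar> = \<bar>int (rank_in B (snd p)) - int (rank_in B (snd p'))\<bar>"
    if "p \<in> line_points B z l" "p' \<in> line_points B z l" for p p'
    using less(2)[OF that(1)] less(2)[OF that(2)] by linarith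
  then have "?E = {(p, p'). p \<in> line_points B z l \<and> p' \<in> line_points B z l \<and> p \<noteq> p' \<and>
            \<bar>int (rank_in B (fst p)) - int (rank_in B (fst p'))\<bar> < int H \<and>
            \<bar>int (rank_in B (snd p)) - int (rank_in B (snd p'))\<bar> < int H}"
    by auto
  ultimately show ?thesis by simp
qed

text \<open>As \<open>c \<noteq> 0\<close>, the line misses the origin, so two distinct points on it
  are linearly independent and determine the coefficients.\<close>

lemma line_through_two_points_unique:
  fixes x y x' y' r s r' s' c :: real
  assumes "(x, y) \<noteq> (x', y')" "c \<noteq> 0"
    and "r * x + s * y = c" "r * x' + s * y' = c" "r' * x + s' * y = c" "r' * x' + s' * y' = c"
  shows "(r, s) = (r', s')"
proof -
  have e: "(r - r') * x + (s - s') * y = 0" "(r - r') * x' + (s - s') * y' = 0"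
    using assms(3-6) by (auto simp: algebra_simps)
  have "(r - r') * (x * y' - x' * y)
      = y' * ((r - r') * x + (s - s') * y) - y * ((r - r') * x' + (s - s') * y')"
    "(s - s') * (x * y' - x' * y)
      = x * ((r - r') * x' + (s - s') * y') - x' * ((r - r') * x + (s - s') * y)"
    by (simp_all add: algebra_simps)
  then have d: "(r - r') * (x * y' - x' * y) = 0" "(s - s') * (x * y' - x' * y) = 0"
    using e by simp_all
  have "x * y' - x' * y \<noteq> 0"
  proof
    assume det: "x * y' - x' * y = 0"
    have c: "c * (x - x') = (r * x' + s * y') * x - (r * x + s * y) * x'"
      "c * (y - y') = (r * x' + s * y') * y - (r * x + s * y) * y'"
      unfolding assms(3,4) by (simp_all add: right_diff_distrib)
    have "(r * x' + s * y') * x - (r * x + s * y) * x' = s * (x * y' - x' * y)"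
      "(r * x' + s * y') * y - (r * x + s * y) * y' = - r * (x * y' - x' * y)"
      by (simp_all add: algebra_simps)
    then have "c * (x - x') = 0" "c * (y - y') = 0"
      using c det by simp_all
    then show False using assms(1,2) by simp
  qed
  then show ?thesis using d by simp
qed

text \<open>Two distinct points determine their line, so close pairs on different lines are
  different. Grouped by coordinates, they inject into pairs of near pairs of \<open>B\<close>,
  whatever \<open>L\<close> is.\<close>

lemma sum_card_line_points_squared_le:
  assumes fin: "finite B" and L: "finite L"
    and t: "4 \<le> t" and H: "H = 8 * card B div t + 1"
  shows "(\<Sum>l\<in>{l \<in> L. t \<le> card (line_points B z l)}. (card (line_points B z l))\<^sup>2)
         \<le> t * (card B * (2 * H))\<^sup>2"
proof -
  let ?L = "{l \<in> L. t \<le> card (line_points B z l)}"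
  define C where "C l = {(p, p'). p \<in> line_points B z l \<and> p' \<in> line_points B z l \<and> p \<noteq> p' \<and>
            \<bar>int (rank_in B (fst p)) - int (rank_in B (fst p'))\<bar> < int H \<and>
            \<bar>int (rank_in B (snd p)) - int (rank_in B (snd p'))\<bar> < int H}" for l
  let ?F = "\<lambda>e. case e of (l :: real \<times> real, (x :: real, y :: real), (x' :: real, y' :: real)) \<Rightarrow> ((x, x'), (y, y'))"
  have finC: "finite (C l)" for l
    unfolding C_def by (rule finite_subset[of _ "line_points B z l \<times> line_points B z l"])
      (use finite_line_points[OF fin] in auto)
  have "(\<Sum>l\<in>?L. card (C l)) \<le> card (near_pairs B H \<times> near_pairs B H)"
  proof (rule sum_card_le_of_inj_on[where F = ?F])
    show "inj_on ?F (SIGMA l:?L. C l)"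
    proof (rule inj_onI)
      fix e1 e2 assume e: "e1 \<in> (SIGMA l:?L. C l)" "e2 \<in> (SIGMA l:?L. C l)" "?F e1 = ?F e2"
      obtain r s x y x' y' where e1: "e1 = ((r, s), (x, y), (x', y'))"
        by (metis prod.collapse)
      obtain r' s' u v u' v' where e2: "e2 = ((r', s'), (u, v), (u', v'))"
        by (metis prod.collapse)
      have eq: "u = x" "u' = x'" "v = y" "v' = y'"
        using e(3) unfolding e1 e2 by auto
      have "(r, s) = (r', s')"
        by (rule line_through_two_points_unique[of "x - z" "y - z" "x' - z" "y' - z" 2])
           (use e(1,2) in \<open>auto simp: e1 e2 eq C_def line_points_def\<close>)
      then show "e1 = e2"
        unfolding e1 e2 using eq by auto
    qed
    show "?F ` (SIGMA l:?L. C l) \<subseteq> near_pairs B H \<times> near_pairs B H"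
      by (auto simp: C_def near_pairs_def line_points_def)
  qed (use L finC finite_near_pairs[OF fin] in auto)
  also have "\<dots> \<le> (card B * (2 * H))\<^sup>2"
    unfolding card_cartesian_product power2_eq_square
    by (intro mult_le_mono card_near_pairs_le[OF fin])
  finally have "t * (\<Sum>l\<in>?L. card (C l)) \<le> t * (card B * (2 * H))\<^sup>2"
    by (rule mult_le_mono2)
  moreover have "(\<Sum>l\<in>?L. (card (line_points B z l))\<^sup>2) \<le> (\<Sum>l\<in>?L. t * card (C l))"
    unfolding C_def using line_points_close_pairs[OF fin t _ H] by (intro sum_mono) auto
  ultimately show ?thesis
    by (simp add: sum_distrib_left)
qed

lemma real_sum_card_line_points_squared_le:
  assumes fin: "finite B" and L: "finite L" and t: "4 \<le> t" "t \<le> 6 * card B"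
  shows "(\<Sum>l\<in>{l \<in> L. t \<le> card (line_points B z l)}. (real (card (line_points B z l)))\<^sup>2)
         \<le> 784 * real (card B) ^ 4 / t"
proof -
  define H where "H = 8 * card B div t + 1"
  \<comment> \<open>The range \<open>t \<le> 6 * card B\<close> gives \<open>14 = 8 + 6\<close>,
    whence the constant \<open>784 = 4 * 14 ^ 2\<close>.\<close>
  have "real H \<le> (8 + real 6) * card B / t"
    using real_side_le[of H "card B" t 6] t by (simp add: H_def)
  then have Hb: "real H \<le> 14 * card B / t" by simp
  have "(\<Sum>l\<in>{l \<in> L. t \<le> card (line_points B z l)}. (real (card (line_points B z l)))\<^sup>2)
     = real (\<Sum>l\<in>{l \<in> L. t \<le> card (line_points B z l)}. (card (line_points B z l))\<^sup>2)"
    by simp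
  also have "\<dots> \<le> real (t * (card B * (2 * H))\<^sup>2)"
    by (intro of_nat_mono sum_card_line_points_squared_le[OF fin L t(1) H_def])
  also have "\<dots> = 4 * t * (real (card B))\<^sup>2 * (real H)\<^sup>2"
    by (simp add: power2_eq_square)
  also have "\<dots> \<le> 4 * t * (real (card B))\<^sup>2 * (14 * card B / t)\<^sup>2"
    using Hb by (intro mult_left_mono power_mono) auto
  also have "\<dots> = 784 * real (card B) ^ 4 / t"
    using t by (simp add: field_simps power2_eq_square power4_eq_xxxx)
  finally show ?thesis .
qed

section \<open>Lines weighted by triples of A\<close>

text \<open>The coefficients in the area equation for vertices with first coordinates
  \<open>c\<close>, \<open>a\<close>, \<open>b\<close>. They are invariant under translation of the
  triple.\<close>

definition triple_line :: "real \<times> real \<times> real \<Rightarrow> real \<times> real" where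
  "triple_line = (\<lambda>(a, b, c). (b - c, c - a))"

definition line_weight :: "real set \<Rightarrow> real \<times> real \<Rightarrow> nat" where
  "line_weight A l = card {\<tau> \<in> A \<times> A \<times> A. triple_line \<tau> = l}"

text \<open>Two triples with the same line differ by a translation, so the second moment of the
  weights is a third moment of the representation function of \<open>A - A\<close>.\<close>

lemma sum_line_weight_squared_le:
  assumes fin: "finite A"
  shows "(\<Sum>l\<in>triple_line ` (A \<times> A \<times> A). (line_weight A l)\<^sup>2)
    \<le> (\<Sum>d\<in>(\<lambda>(x, y). y - x) ` (A \<times> A). card (diff_reps A d) ^ 3)"
proof -
  let ?L = "triple_line ` (A \<times> A \<times> A)" and ?D = "(\<lambda>(x, y). y - x) ` (A \<times> A)"
  define W where "W l = {\<tau> \<in> A \<times> A \<times> A. triple_line \<tau> = l}" for l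
  have finW: "finite (W l)" for l unfolding W_def using fin by simp
  let ?N = "SIGMA d:?D. diff_reps A d \<times> diff_reps A d \<times> diff_reps A d"
  \<comment> \<open>Equal lines force \<open>a' - a = b' - b = c' - c\<close>, so three pairs
    represent one difference.\<close>
  let ?F = "\<lambda>e. case e of (l :: real \<times> real, (a :: real, b :: real, c :: real), (a' :: real, b' :: real, c' :: real)) \<Rightarrow>
      (a' - a, (a, a'), (b, b'), (c, c'))"
  have "(\<Sum>l\<in>?L. card (W l \<times> W l)) \<le> card ?N"
  proof (rule sum_card_le_of_inj_on[where F = ?F])
    show "inj_on ?F (SIGMA l:?L. W l \<times> W l)"
      by (auto simp: inj_on_def W_def)
    show "?F ` (SIGMA l:?L. W l \<times> W l) \<subseteq> ?N"
      by (auto simp: W_def triple_line_def diff_reps_def)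
    show "finite ?N"
      using fin finite_diff_reps[OF fin] by (intro finite_SigmaI) auto
  qed (use fin finW in auto)
  also have "card ?N = (\<Sum>d\<in>?D. card (diff_reps A d \<times> diff_reps A d \<times> diff_reps A d))"
    using fin finite_diff_reps[OF fin] by (intro card_SigmaI) auto
  finally show ?thesis
    by (simp add: card_cartesian_product line_weight_def W_def power2_eq_square power3_eq_cube
        mult.assoc)
qed

text \<open>Lines with fewer than \<open>k\<close> points cost at most \<open>k\<close> per triple.
  For the others, \<open>w * i \<le> \<mu> * w\<^sup>2 + i\<^sup>2 / \<mu>\<close>, with
  \<open>\<mu>\<close> left free to balance the two moments.\<close>

lemma sum_line_points_triples_le:
  fixes \<mu> :: real
  assumes A: "finite A" and B: "finite B" and k: "4 \<le> k" "k \<le> 6 * card B" and \<mu>: "0 < \<mu>"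
  shows "(\<Sum>\<tau>\<in>A \<times> A \<times> A. real (card (line_points B z (triple_line \<tau>))))
    \<le> k * real (card A) ^ 3
      + \<mu> * (\<Sum>l\<in>triple_line ` (A \<times> A \<times> A). (real (line_weight A l))\<^sup>2)
      + 784 * real (card B) ^ 4 / k / \<mu>"
proof -
  let ?T = "A \<times> A \<times> A"
  let ?L = "triple_line ` ?T"
  let ?w = "\<lambda>l. real (line_weight A l)" and ?i = "\<lambda>l. real (card (line_points B z l))"
  have finT: "finite ?T" using A by simp
  have "(\<Sum>\<tau>\<in>?T. ?i (triple_line \<tau>))
      = (\<Sum>l\<in>?L. \<Sum>\<tau>\<in>{\<tau> \<in> ?T. triple_line \<tau> = l}. ?i (triple_line \<tau>))"
    by (rule sum.image_gen[OF finT])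
  also have "\<dots> = (\<Sum>l\<in>?L. ?w l * ?i l)"
    by (intro sum.cong refl) (simp add: line_weight_def)
  also have "\<dots> \<le> (\<Sum>l\<in>?L. k * ?w l + \<mu> * (?w l)\<^sup>2
      + (if k \<le> card (line_points B z l) then (?i l)\<^sup>2 / \<mu> else 0))"
  proof (rule sum_mono)
    fix l
    have am_gm: "?w l * ?i l \<le> \<mu> * (?w l)\<^sup>2 + (?i l)\<^sup>2 / \<mu>"
    proof -
      have "0 \<le> (\<mu> * ?w l - ?i l)\<^sup>2 + \<mu> * ?w l * ?i l"
        using \<mu> by simp
      then have "\<mu> * (?w l * ?i l) \<le> \<mu> * (\<mu> * (?w l)\<^sup>2 + (?i l)\<^sup>2 / \<mu>)"
        using \<mu> by (simp add: power2_eq_square algebra_simps)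
      then show ?thesis using \<mu> by simp
    qed
    show "?w l * ?i l \<le> k * ?w l + \<mu> * (?w l)\<^sup>2
      + (if k \<le> card (line_points B z l) then (?i l)\<^sup>2 / \<mu> else 0)"
    proof (cases "k \<le> card (line_points B z l)")
      case True
      have "0 \<le> k * ?w l" by simp
      then have "?w l * ?i l \<le> k * ?w l + \<mu> * (?w l)\<^sup>2 + (?i l)\<^sup>2 / \<mu>"
        using am_gm by linarith
      then show ?thesis using True by simp
    next
      case False
      then have "?w l * ?i l \<le> ?w l * k" by (intro mult_left_mono) auto
      moreover have "0 \<le> \<mu> * (?w l)\<^sup>2" using \<mu> by simp
      ultimately show ?thesis using False by (simp add: mult.commute)
    qed
  qed
  also have "\<dots> = k * (\<Sum>l\<in>?L. ?w l) + \<mu> * (\<Sum>l\<in>?L. (?w l)\<^sup>2)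
      + (\<Sum>l\<in>{l \<in> ?L. k \<le> card (line_points B z l)}. (?i l)\<^sup>2) / \<mu>"
    using finT
    by (simp add: sum.distrib sum_distrib_left sum_divide_distrib, simp add: sum.inter_filter)
  also have "(\<Sum>l\<in>?L. ?w l) = real (card A) ^ 3"
  proof -
    have "card ?T = (\<Sum>l\<in>?L. line_weight A l)"
      using sum.image_gen[OF finT, of "\<lambda>_. 1::nat" triple_line] by (simp add: line_weight_def)
    then have "real (card ?T) = (\<Sum>l\<in>?L. ?w l)"
      by simp
    then show ?thesis
      by (simp add: card_cartesian_product power3_eq_cube mult.assoc)
  qed
  also have "(\<Sum>l\<in>{l \<in> ?L. k \<le> card (line_points B z l)}. (?i l)\<^sup>2) / \<mu>
      \<le> 784 * real (card B) ^ 4 / k / \<mu>"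
    using \<mu> finT by (intro divide_right_mono real_sum_card_line_points_squared_le[OF B _ k]) auto
  finally show ?thesis by simp
qed

text \<open>With \<open>k\<close> of order \<open>m powr (3/7)\<close> and
  \<open>\<mu> = m powr (1/7)\<close>, the three terms have exponents \<open>3/7 + 3\<close>,
  \<open>1/7 + 23/7\<close> and \<open>4 - 3/7 - 1/7\<close>, all equal to \<open>24/7\<close>. The
  constants add up to \<open>6 + 1458 + 784 = 2248\<close>.\<close>

lemma sum_line_points_triples_powr_le:
  assumes A: "convex_finite_set A" and B: "finite B" and m: "card A = m" "card B = m" "0 < m"
  shows "(\<Sum>\<tau>\<in>A \<times> A \<times> A. real (card (line_points B z (triple_line \<tau>)))) \<le> 2248 * real m powr (24 / 7)"
proof -
  have finA: "finite A" using A by (simp add: convex_finite_set_def)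
  \<comment> \<open>The \<open>+ 4\<close> secures \<open>4 \<le> k\<close>; since
    \<open>m powr (3/7) \<ge> 1\<close>, rounding and shift still leave
    \<open>k \<le> 6 * m powr (3/7)\<close>.\<close>
  define k where "k = nat \<lceil>real m powr (3 / 7)\<rceil> + 4"
  define \<mu> where "\<mu> = real m powr (1 / 7)"
  have m1: "1 \<le> real m" using m by simp
  have p1: "1 \<le> real m powr (3 / 7)" using m1 by (simp add: ge_one_powr_ge_zero)
  have pm: "real m powr (3 / 7) \<le> real m" using m1 powr_mono[of "3/7" 1 "real m"] by simp
  have klo: "real m powr (3 / 7) \<le> k" unfolding k_def by linarith
  have "real k \<le> real m powr (3 / 7) + 5" unfolding k_def using p1 by linarith
  then have khi: "real k \<le> 6 * real m powr (3 / 7)" using p1 by linarith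
  then have "real k \<le> real (6 * m)" using pm by simp
  then have k: "4 \<le> k" "k \<le> 6 * card B" using m by (auto simp: k_def)
  have \<mu>0: "0 < \<mu>" using m by (simp add: \<mu>_def)
  have pw: "real m ^ 3 = real m powr 3" "real m ^ 4 = real m powr 4"
    using m by (simp_all add: powr_numeral)
  let ?D = "(\<lambda>(x, y). y - x) ` (A \<times> A)"
  have "(\<Sum>l\<in>triple_line ` (A \<times> A \<times> A). (real (line_weight A l))\<^sup>2)
      = real (\<Sum>l\<in>triple_line ` (A \<times> A \<times> A). (line_weight A l)\<^sup>2)" by simp
  also have "\<dots> \<le> real (\<Sum>d\<in>?D. card (diff_reps A d) ^ 3)"
    by (intro of_nat_mono sum_line_weight_squared_le finA)
  also have "\<dots> = (\<Sum>d\<in>?D. real (card (diff_reps A d)) ^ 3)" by simp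
  also have "\<dots> \<le> 324 * real m ^ 3 * (\<Sum>t = 1..m. 1 / real t)"
    using sum_card_diff_reps_cubed_le[OF A, of ?D] finA m by simp
  \<comment> \<open>Here \<open>\<epsilon> = 2/7\<close>, so the constant becomes
    \<open>324 * (1 + 7/2) = 1458\<close>.\<close>
  also have "\<dots> \<le> 324 * real m ^ 3 * ((1 + 1 / (2 / 7)) * real m powr (2 / 7))"
    by (intro mult_left_mono sum_inverse_le_powr) auto
  also have "\<dots> = 1458 * (real m powr 3 * real m powr (2 / 7))"
    unfolding pw by simp
  also have "\<dots> = 1458 * real m powr (23 / 7)"
    by (simp add: powr_add[symmetric] del: powr_numeral)
  finally have "\<mu> * (\<Sum>l\<in>triple_line ` (A \<times> A \<times> A). (real (line_weight A l))\<^sup>2)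
      \<le> \<mu> * (1458 * real m powr (23 / 7))"
    using \<mu>0 by (intro mult_left_mono) auto
  also have "\<dots> = 1458 * real m powr (24 / 7)"
    unfolding \<mu>_def by (simp add: powr_add[symmetric] del: powr_numeral)
  finally have second: "\<mu> * (\<Sum>l\<in>triple_line ` (A \<times> A \<times> A). (real (line_weight A l))\<^sup>2)
      \<le> 1458 * real m powr (24 / 7)" .
  have "k * real (card A) ^ 3 \<le> 6 * real m powr (3 / 7) * real m powr 3"
    unfolding m pw using khi by (intro mult_right_mono) auto
  also have "\<dots> = 6 * real m powr (24 / 7)"
    by (simp add: powr_add[symmetric] del: powr_numeral)
  finally have first: "k * real (card A) ^ 3 \<le> 6 * real m powr (24 / 7)" .
  have "784 * real (card B) ^ 4 / k / \<mu> \<le> 784 * real m powr 4 / real m powr (3 / 7) / \<mu>"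
    unfolding m(1,2) pw using klo p1 \<mu>0 m(3) by (intro divide_right_mono divide_left_mono mult_pos_pos) auto
  also have "\<dots> = 784 * real m powr (24 / 7)"
    unfolding \<mu>_def times_divide_eq_right[symmetric] powr_diff[symmetric] by simp
  finally have third: "784 * real (card B) ^ 4 / k / \<mu> \<le> 784 * real m powr (24 / 7)" .
  show ?thesis
    using sum_line_points_triples_le[OF finA B k \<mu>0, of z] first second third by linarith
qed

section \<open>Counting the triangles\<close>

text \<open>\<open>((z, a, b, c), (x, y))\<close> encodes the vertices \<open>(c, z)\<close>,
  \<open>(a, x)\<close>, \<open>(b, y)\<close>: the first component fixes a line, the second a point
  on it.\<close>

definition unit_area_tuples ::
    "real set \<Rightarrow> real set \<Rightarrow> ((real \<times> real \<times> real \<times> real) \<times> real \<times> real) set" where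
  "unit_area_tuples A B =
     (SIGMA e:B \<times> A \<times> A \<times> A. line_points B (fst e) (triple_line (snd e)))"

text \<open>Every triangle arises from some tuple; arising from several is harmless for an upper
  bound.\<close>

lemma card_unit_area_triangles_le:
  assumes "finite A" "finite B"
  shows "card (unit_area_triangles (planar_grid A B)) \<le> card (unit_area_tuples A B)"
proof -
  let ?V = "\<lambda>e. case e of ((z, a, b, c), (x, y)) \<Rightarrow> {vector [c, z], vector [a, x], vector [b, y] :: real^2}"
  have fin: "finite (unit_area_tuples A B)"
    unfolding unit_area_tuples_def using assms finite_line_points by (intro finite_SigmaI) auto
  have "unit_area_triangles (planar_grid A B) \<subseteq> ?V ` unit_area_tuples A B"
  proof
    fix T assume T: "T \<in> unit_area_triangles (planar_grid A B)"
    then have "card T = 3" by (simp add: unit_area_triangles_def)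
    then obtain P Q R where PQR: "T = {P, Q, R}" by (auto simp: card_3_iff)
    have vec: "vector [p $ 1, p $ 2] = p" for p :: "real^2"
      by (simp add: vec_eq_iff forall_2)
    have witness: "T \<in> ?V ` unit_area_tuples A B"
      if Q: "T = {P, Q, R}"
        "(R $ 1 - P $ 1) * (Q $ 2 - P $ 2) - (Q $ 1 - P $ 1) * (R $ 2 - P $ 2) = 2" for P Q R
    proof (rule image_eqI)
      show "T = ?V ((P $ 2, Q $ 1, R $ 1, P $ 1), (Q $ 2, R $ 2))"
        using Q(1) by (simp add: vec)
      show "((P $ 2, Q $ 1, R $ 1, P $ 1), (Q $ 2, R $ 2)) \<in> unit_area_tuples A B"
        using T Q by (auto simp: unit_area_tuples_def unit_area_triangles_def planar_grid_def
            line_points_def triple_line_def algebra_simps)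
    qed
    \<comment> \<open>The area is half this absolute determinant. Exchanging \<open>Q\<close> and
      \<open>R\<close> flips the sign, so one of the two orders gives the value 2.\<close>
    have "\<bar>(R $ 1 - P $ 1) * (Q $ 2 - P $ 2) - (Q $ 1 - P $ 1) * (R $ 2 - P $ 2)\<bar> = 2"
      using T content_triangle[of P Q R] PQR by (simp add: unit_area_triangles_def)
    then consider "(R $ 1 - P $ 1) * (Q $ 2 - P $ 2) - (Q $ 1 - P $ 1) * (R $ 2 - P $ 2) = 2"
      | "(Q $ 1 - P $ 1) * (R $ 2 - P $ 2) - (R $ 1 - P $ 1) * (Q $ 2 - P $ 2) = 2"
      by linarith
    then show "T \<in> ?V ` unit_area_tuples A B"
      using witness[of P Q R] witness[of P R Q] PQR by (cases; blast)
  qed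
  then have "card (unit_area_triangles (planar_grid A B)) \<le> card (?V ` unit_area_tuples A B)"
    using fin by (intro card_mono) auto
  also have "\<dots> \<le> card (unit_area_tuples A B)"
    by (rule card_image_le[OF fin])
  finally show ?thesis .
qed

lemma card_unit_area_triangles_convex_grid_le:
  assumes A: "convex_finite_set A" and B: "finite B" and m: "card A = m" "card B = m"
  shows "real (card (unit_area_triangles (planar_grid A B))) \<le> 2248 * real m powr (31 / 7)"
proof -
  have finA: "finite A" using A by (simp add: convex_finite_set_def)
  have "real (card (unit_area_triangles (planar_grid A B))) \<le> real (card (unit_area_tuples A B))"
    using card_unit_area_triangles_le[OF finA B] by simp
  also have "\<dots> = (\<Sum>e\<in>B \<times> A \<times> A \<times> A. real (card (line_points B (fst e) (triple_line (snd e)))))"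
    unfolding unit_area_tuples_def using finA B finite_line_points[OF B] by (subst card_SigmaI) auto
  also have "\<dots> = (\<Sum>z\<in>B. \<Sum>\<tau>\<in>A \<times> A \<times> A. real (card (line_points B z (triple_line \<tau>))))"
    by (simp add: sum.cartesian_product case_prod_unfold)
  also have "\<dots> \<le> (\<Sum>z\<in>B. 2248 * real m powr (24 / 7))"
  proof (rule sum_mono)
    fix z assume "z \<in> B"
    \<comment> \<open>An element of \<open>B\<close> makes \<open>m\<close> positive; for empty
      \<open>B\<close> the sum is empty.\<close>
    then have "0 < m" using B m(2) card_gt_0_iff by blast
    then show "(\<Sum>\<tau>\<in>A \<times> A \<times> A. real (card (line_points B z (triple_line \<tau>)))) \<le> 2248 * real m powr (24 / 7)"
      by (rule sum_line_points_triples_powr_le[OF A B m])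
  qed
  also have "\<dots> = 2248 * (real m powr 1 * real m powr (24 / 7))"
    using m by simp
  also have "\<dots> = 2248 * real m powr (31 / 7)"
    by (simp only: powr_add[symmetric]) simp
  finally show ?thesis .
qed

theorem theorem4p1:
  shows "\<exists>C::real. \<forall>(n::nat) (A::real set) (B::real set).
           convex_finite_set A \<longrightarrow> convex_finite_set B \<longrightarrow>
           real (card A) = sqrt (real n) \<longrightarrow> real (card B) = sqrt (real n) \<longrightarrow>
           real (card (unit_area_triangles (planar_grid A B))) \<le> C * real n powr (31 / 14)"
proof (intro exI[of _ 2248] allI impI)
  fix n :: nat and A B :: "real set"
  assume A: "convex_finite_set A" and B: "convex_finite_set B"
    and cA: "real (card A) = sqrt (real n)" and cB: "real (card B) = sqrt (real n)"
  have "card B = card A" using cA cB by simp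
  then have "real (card (unit_area_triangles (planar_grid A B))) \<le> 2248 * real (card A) powr (31 / 7)"
    using A B by (intro card_unit_area_triangles_convex_grid_le) (auto simp: convex_finite_set_def)
  also have "real (card A) powr (31 / 7) = real n powr (31 / 14)"
    unfolding cA by (simp add: powr_half_sqrt[symmetric] powr_powr)
  finally show "real (card (unit_area_triangles (planar_grid A B))) \<le> 2248 * real n powr (31 / 14)" .
qed

end
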